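(* Let $\lambda_k<\lambda_{k+1}$ be real numbers and define $$\delta(s)=\min\{s-\lambda_k,\ \lambda_{k+1}-s\},\qquad s\in(\lambda_k,\lambda_{k+1}).$$ Then $\delta$ is uniquely maximized at $$s_\star=\frac{\lambda_k+\lambda_{k+1}}{2},$$ with maximum value $\delta(s_\star)=\dfrac{\lambda_{k+1}-\lambda_k}{2}$. *)

theory Defs
  imports Complex_Main
begin

(* Defined for every real s; the restriction to the open gap {a<..<b} is imposed
   wherever the function is maximised. *)
definition gap_margin :: "real \<Rightarrow> real \<Rightarrow> real \<Rightarrow> real" where
  "gap_margin a b s = min (s - a) (b - s)"

end

theory Submission
  imports Defs
begin

text \<open>The two distances \<open>s - a\<close> and \<open>b - s\<close> have constant sum \<open>b - a\<close>, so their minimum is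
  half of that sum less the distance of \<open>s\<close> from the midpoint. Hence maximising the margin
  amounts to minimising the distance to the midpoint, and the midpoint lies in the gap.\<close>

lemma gap_margin_eq_half_width_minus_dist:
  "gap_margin a b s = (b - a) / 2 - \<bar>s - (a + b) / 2\<bar>"
  by (auto simp: gap_margin_def min_def abs_if field_simps)

theorem proposition4p1:
  fixes a b :: real
  assumes "a < b"
  shows "(\<forall>s. is_arg_max (gap_margin a b) (\<lambda>s. s \<in> {a<..<b}) s \<longleftrightarrow> s = (a + b) / 2)
    \<and> gap_margin a b ((a + b) / 2) = (b - a) / 2"
proof -
  have mid: "(a + b) / 2 \<in> {a<..<b}"
    using assms by simp
  have "is_arg_max (gap_margin a b) (\<lambda>s. s \<in> {a<..<b}) s \<longleftrightarrow> s = (a + b) / 2" for s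
  proof
    assume "is_arg_max (gap_margin a b) (\<lambda>s. s \<in> {a<..<b}) s"
    with mid have "\<not> gap_margin a b s < gap_margin a b ((a + b) / 2)"
      unfolding is_arg_max_def by blast
    then show "s = (a + b) / 2"
      unfolding gap_margin_eq_half_width_minus_dist by linarith
  next
    assume s: "s = (a + b) / 2"
    have "gap_margin a b y \<le> gap_margin a b s" for y
      unfolding s gap_margin_eq_half_width_minus_dist by linarith
    with mid s show "is_arg_max (gap_margin a b) (\<lambda>s. s \<in> {a<..<b}) s"
      by (metis is_arg_max_def not_less)
  qed
  then show ?thesis
    by (simp add: gap_margin_eq_half_width_minus_dist)
qed

end
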